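(* Let $\{\tau_n\}_{n=1}^\infty$ be a sequence of nonnegative real numbers and $\{a_n\}_{n=1}^\infty$ a nondecreasing sequence of strictly positive real numbers. Suppose there are finite real constants $\theta\ge1$, $C>0$ and $N\ge2$ such that for all $n\ge N$ $$\frac{a_n^{2\theta}}{n^{\theta-1}}\sum_{k=n}^\infty\frac{k^\theta\tau_k}{a_k^{2\theta}}\le C\sum_{k=1}^{n-1}k\tau_k,$$ and suppose that $$\liminf_{n\to\infty}\ \inf_{k\ge n}\ \frac{a_k^2}{k\,a_n^2}\sum_{j=1}^{n-1}j\tau_j>0 .$$ Then for any real random variable $X_1$ such that $\sum_{n=1}^\infty n\tau_nP(|X_1|\ge\varepsilon a_n)<\infty$ for all $\varepsilon>0$, we have $$\sum_{n=1}^\infty\tau_n e^{-\varepsilon^2a_n^2/(nT_{\varepsilon,n})}<\infty\quad\text{for all }\varepsilon>0,$$ where $T_{\varepsilon,n}=E[X_1^2\cdot1_{\{|X_1|<\varepsilon a_n\}}]$ and where $e^{-t/0}=0$ for all $t>0$. *)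

theory Defs
  imports "HOL-Probability.Probability"
begin

text \<open>The value of \<open>exp (- t / d)\<close> for \<open>t > 0\<close> and \<open>d \<ge> 0\<close>, with the convention that it
  is \<open>0\<close> for \<open>d = 0\<close> (division in HOL would give \<open>exp 0 = 1\<close> there).\<close>

definition exp_neg_div :: "real \<Rightarrow> real \<Rightarrow> real" where
  "exp_neg_div t d = (if d = 0 then 0 else exp (- t / d))"

definition trunc_second_moment :: "'w measure \<Rightarrow> ('w \<Rightarrow> real) \<Rightarrow> real \<Rightarrow> real" where
  "trunc_second_moment M X c = (\<integral>\<omega>. (X \<omega>)\<^sup>2 * indicator {\<omega>. \<bar>X \<omega>\<bar> < c} \<omega> \<partial>M)"

end

theory Submission
  imports Defs
begin

text \<open>Write \<open>G n\<close> for the truncated second moment at level \<open>\<epsilon> a n\<close>, \<open>p n\<close> for the tail probability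
  there, and \<open>S n = (\<Sum>j=1..<n. j \<tau> j)\<close>. Then \<open>G (n+1) - G n \<le> \<epsilon>\<^sup>2 (a (n+1))\<^sup>2 (p n - p (n+1))\<close>,
  and Abel summation turns the hypothesis on \<open>X\<close> into \<open>(\<Sum>n. (p n - p (n+1)) S (n+1)) < \<infinity>\<close>. With
  the liminf condition this bounds \<open>n G n / (a n)\<^sup>2\<close>. As \<open>exp (-y) \<le> (\<theta>/y) powr \<theta>\<close>, it is
  enough to bound \<open>(\<Sum>n. w n * G n powr \<theta>)\<close> with \<open>w n = n powr \<theta> * \<tau> n / a n powr (2\<theta>)\<close>. A
  second Abel summation, convexity of \<open>x powr \<theta>\<close>, and the tail condition bound its terms by
  multiples of \<open>(p n - p (n+1)) S (n+1) (n G n / (a n)\<^sup>2) powr (\<theta>-1)\<close>.\<close>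

section \<open>Summation by parts and elementary inequalities\<close>

lemma abel_sum_initial:
  fixes p \<sigma> :: "nat \<Rightarrow> real"
  shows "(\<Sum>n=1..<K. (p n - p (Suc n)) * (\<Sum>j=1..<Suc n. \<sigma> j)) + p K * (\<Sum>j=1..<K. \<sigma> j)
    = (\<Sum>j=1..<K. \<sigma> j * p j)"
proof (induction K)
  case (Suc K)
  show ?case
  \<comment> \<open>At \<open>K = 0\<close> the range \<open>1..<Suc K\<close> is still empty, so no
    last term can be split off.\<close>
  proof (cases "K = 0")
    case False
    then have split: "(\<Sum>j=1..<Suc K. f j) = (\<Sum>j=1..<K. f j) + f K" for f :: "nat \<Rightarrow> real"
      by simp
    show ?thesis using Suc unfolding split[of "\<lambda>n. (p n - p (Suc n)) * (\<Sum>j=1..<Suc n. \<sigma> j)"]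
        split[of "\<lambda>j. \<sigma> j * p j"] split[of \<sigma>]
      by (simp add: algebra_simps)
  qed simp
qed simp

text \<open>Substitute \<open>w k = V k - V (Suc k)\<close> and shift the index. The recursion
  stands for "\<open>V\<close> is the tail sum of \<open>w\<close>", so no convergence question
  enters here.\<close>

lemma abel_sum_tail:
  fixes g w V :: "nat \<Rightarrow> real"
  assumes "\<And>n. n \<ge> m \<Longrightarrow> V n = w n + V (Suc n)"
  shows "(\<Sum>k=m..<m+K. w k * g k)
    = g m * V m + (\<Sum>k=m..<m+K. (g (Suc k) - g k) * V (Suc k)) - g (m+K) * V (m+K)"
proof (induction K)
  case (Suc K)
  show ?case using Suc assms[of "m+K"] by (simp add: algebra_simps)
qed simp

text \<open>Mean value theorem: the derivative \<open>\<theta> * z powr (\<theta> - 1)\<close> is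
  nondecreasing because \<theta> \<ge> 1. The endpoint \<open>y = 0\<close> is checked by hand,
  since the derivative rule is applied at positive points only.\<close>

lemma powr_diff_le:
  fixes x y \<theta> :: real
  assumes "0 \<le> y" "y \<le> x" "\<theta> \<ge> 1"
  shows "x powr \<theta> - y powr \<theta> \<le> \<theta> * x powr (\<theta> - 1) * (x - y)"
proof (cases "y = x \<or> y = 0")
  case True
  show ?thesis
  proof (cases "y = x")
    case False
    with True assms have "y = 0" "x > 0" by auto
    have "x powr \<theta> = 1 * x powr (\<theta> - 1) * x" using \<open>x > 0\<close> by (simp add: powr_diff)
    also have "\<dots> \<le> \<theta> * x powr (\<theta> - 1) * x"
      by (intro mult_right_mono) (use assms in auto)
    finally show ?thesis using \<open>y = 0\<close> by simp
  qed simp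
next
  case False
  then have "0 < y" "y < x" using assms by auto
  then obtain z where z: "y < z" "z < x"
    "x powr \<theta> - y powr \<theta> = (x - y) * (\<theta> * z powr (\<theta> - 1))"
    using MVT2[of y x "\<lambda>t. t powr \<theta>" "\<lambda>z. \<theta> * z powr (\<theta> - 1)"]
      has_real_derivative_powr by force
  have "z powr (\<theta> - 1) \<le> x powr (\<theta> - 1)"
    by (rule powr_mono2) (use z \<open>0 < y\<close> assms in auto)
  then have "(x - y) * (\<theta> * z powr (\<theta> - 1)) \<le> (x - y) * (\<theta> * x powr (\<theta> - 1))"
    by (intro mult_left_mono) (use assms in auto)
  with z show ?thesis by (simp add: mult_ac)
qed

lemma square_powr:
  fixes x t :: real
  assumes "x > 0"
  shows "(x\<^sup>2) powr t = x powr (2 * t)"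
  using powr_powr[of x 2 t] assms by simp

text \<open>Raise \<open>u \<le> exp u\<close> at \<open>u = y / \<theta>\<close> to the power
  \<theta> and invert.\<close>

lemma exp_neg_le_powr:
  fixes y \<theta> :: real
  assumes "y > 0" "\<theta> > 0"
  shows "exp (- y) \<le> (\<theta> / y) powr \<theta>"
proof -
  have "y / \<theta> \<le> exp (y / \<theta>)" using exp_ge_add_one_self[of "y / \<theta>"] by linarith
  then have "(y / \<theta>) powr \<theta> \<le> exp (y / \<theta>) powr \<theta>"
    by (intro powr_mono2) (use assms in auto)
  also have "\<dots> = exp y" using assms by (simp add: powr_def)
  finally have "exp (- y) \<le> inverse ((y / \<theta>) powr \<theta>)"
    using assms by (simp add: exp_minus le_imp_inverse_le)
  also have "\<dots> = (\<theta> / y) powr \<theta>"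
    using assms by (simp add: powr_divide)
  finally show ?thesis .
qed

text \<open>At \<open>d = 0\<close> the right side is 0, so the convention in
  \<open>exp_neg_div\<close> is exactly what keeps the bound true there.\<close>

lemma exp_neg_div_le_powr:
  assumes "t > 0" "d \<ge> 0" "\<theta> > 0"
  shows "exp_neg_div t d \<le> (\<theta> * d / t) powr \<theta>"
proof (cases "d = 0")
  case False
  then show ?thesis using exp_neg_le_powr[of "t / d" \<theta>] assms by (simp add: exp_neg_div_def)
qed (simp add: exp_neg_div_def)

section \<open>Truncated second moments\<close>

context prob_space
begin

lemma integrable_trunc_square:
  assumes [measurable]: "X \<in> borel_measurable M"
  shows "integrable M (\<lambda>\<omega>. (X \<omega>)\<^sup>2 * indicator {\<omega>. \<bar>X \<omega>\<bar> < c} \<omega> :: real)"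
proof (rule integrable_const_bound[where B = "c\<^sup>2"])
  show "AE \<omega> in M. norm ((X \<omega>)\<^sup>2 * indicator {\<omega>. \<bar>X \<omega>\<bar> < c} \<omega> :: real) \<le> c\<^sup>2"
    by (rule AE_I2) (auto simp: indicator_def abs_le_square_iff[symmetric])
qed simp

lemma trunc_second_moment_nonneg: "trunc_second_moment M X c \<ge> 0"
  unfolding trunc_second_moment_def by (intro integral_nonneg_AE) auto

lemma trunc_second_moment_mono:
  assumes "X \<in> borel_measurable M" "c \<le> d"
  shows "trunc_second_moment M X c \<le> trunc_second_moment M X d"
  unfolding trunc_second_moment_def
  by (intro integral_mono integrable_trunc_square) (use assms in \<open>auto simp: indicator_def\<close>)

text \<open>The difference integrates the square of \<open>X\<close> over the event
  \<open>c \<le> \<bar>X \<omega>\<bar> < d\<close>. There the square is at most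
  \<open>d\<^sup>2\<close>, and the indicator of the event is the difference of the two tail
  indicators.\<close>

lemma trunc_second_moment_diff_le:
  assumes [measurable]: "X \<in> borel_measurable M" and "0 \<le> c" "c \<le> d"
  shows "trunc_second_moment M X d - trunc_second_moment M X c
    \<le> d\<^sup>2 * (\<P>(\<omega> in M. \<bar>X \<omega>\<bar> \<ge> c) - \<P>(\<omega> in M. \<bar>X \<omega>\<bar> \<ge> d))"
proof -
  let ?A = "{\<omega> \<in> space M. \<bar>X \<omega>\<bar> \<ge> c}" and ?B = "{\<omega> \<in> space M. \<bar>X \<omega>\<bar> \<ge> d}"
  let ?f = "\<lambda>e \<omega>. (X \<omega>)\<^sup>2 * indicator {\<omega>. \<bar>X \<omega>\<bar> < e} \<omega> :: real"
  have "trunc_second_moment M X d - trunc_second_moment M X c = (\<integral>\<omega>. ?f d \<omega> - ?f c \<omega> \<partial>M)"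
    unfolding trunc_second_moment_def
    by (subst Bochner_Integration.integral_diff) (auto intro: integrable_trunc_square)
  also have "\<dots> \<le> (\<integral>\<omega>. d\<^sup>2 * (indicator ?A \<omega> - indicator ?B \<omega>) \<partial>M)"
  proof (rule integral_mono)
    show "integrable M (\<lambda>\<omega>. ?f d \<omega> - ?f c \<omega>)"
      by (intro Bochner_Integration.integrable_diff integrable_trunc_square assms)
    show "integrable M (\<lambda>\<omega>. d\<^sup>2 * (indicator ?A \<omega> - indicator ?B \<omega>) :: real)"
      by (auto simp: emeasure_eq_measure)
    show "?f d \<omega> - ?f c \<omega> \<le> d\<^sup>2 * (indicator ?A \<omega> - indicator ?B \<omega>)" if "\<omega> \<in> space M" for \<omega>
      using that assms(2,3) by (auto simp: indicator_def abs_le_square_iff[symmetric])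
  qed
  also have "\<dots> = d\<^sup>2 * (prob ?A - prob ?B)"
    by (auto simp: emeasure_eq_measure)
  finally show ?thesis .
qed

end

section \<open>The deterministic core\<close>

text \<open>All that is kept of \<open>X\<close> is the increment bound for \<open>G\<close> and the
  weighted sum of the tails \<open>p\<close>; in the application \<open>e\<close> is
  \<open>\<epsilon>\<^sup>2\<close> and \<open>m\<close> is an index past which all asymptotic
  hypotheses hold.\<close>

lemma summable_powr_of_tail_bounds:
  fixes \<tau> a G p :: "nat \<Rightarrow> real" and \<theta> C c e D :: real and m :: nat
  defines "S n \<equiv> \<Sum>j = 1..<n. real j * \<tau> j"
  defines "w n \<equiv> real n powr \<theta> * \<tau> n / a n powr (2 * \<theta>)"
  assumes tau: "\<And>n. n \<ge> 1 \<Longrightarrow> \<tau> n \<ge> 0"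
    and a_pos: "\<And>n. n \<ge> 1 \<Longrightarrow> a n > 0"
    and const: "\<theta> \<ge> 1" "C > 0" "c > 0" "e \<ge> 0" "m \<ge> 1"
    and G0: "\<And>n. G n \<ge> 0" and G_mono: "\<And>n. n \<ge> 1 \<Longrightarrow> G n \<le> G (Suc n)"
    and G_diff: "\<And>n. n \<ge> 1 \<Longrightarrow> G (Suc n) - G n \<le> e * (a (Suc n))\<^sup>2 * (p n - p (Suc n))"
    and p0: "\<And>n. p n \<ge> 0" and p_mono: "\<And>n. n \<ge> 1 \<Longrightarrow> p (Suc n) \<le> p n"
    and D: "\<And>K. (\<Sum>j = 1..<K. real j * \<tau> j * p j) \<le> D"
    and w_sum: "summable (\<lambda>i. w (m + i))"
    and w_tail: "\<And>n. n \<ge> m \<Longrightarrow> (\<Sum>i. w (n + i)) \<le> C * real n powr (\<theta> - 1) * S n / a n powr (2 * \<theta>)"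
    and growth: "\<And>n k. n \<ge> m \<Longrightarrow> k \<ge> n \<Longrightarrow> c * (real k * (a n)\<^sup>2) \<le> (a k)\<^sup>2 * S n"
  shows "summable (\<lambda>i. w (m + i) * G (m + i) powr \<theta>)"
proof -
  define q where "q n = p n - p (Suc n)" for n
  have q0: "q n \<ge> 0" if "n \<ge> 1" for n using p_mono[OF that] by (simp add: q_def)
  have S0: "S n \<ge> 0" for n unfolding S_def by (intro sum_nonneg) (use tau in auto)
  have w0: "w n \<ge> 0" if "n \<ge> 1" for n unfolding w_def using tau[OF that] by simp
  \<comment> \<open>First Abel summation: enlarging the range down to 1 and adding the boundary term
    \<open>p K * S K\<close> only increases the sum, which then equals the one bounded by
    \<open>D\<close>.\<close>
  have qS: "(\<Sum>n = m..<K. q n * S (Suc n)) \<le> D" for K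
  proof -
    have "(\<Sum>n = m..<K. q n * S (Suc n)) \<le> (\<Sum>n = 1..<K. q n * S (Suc n))"
      by (intro sum_mono2) (use const q0 S0 in auto)
    also have "\<dots> \<le> (\<Sum>n = 1..<K. q n * S (Suc n)) + p K * S K"
      using p0 S0 by simp
    also have "\<dots> \<le> D"
      using D[of K] abel_sum_initial[of p "\<lambda>j. real j * \<tau> j" K]
      unfolding q_def S_def by simp
    finally show ?thesis .
  qed
  have D0: "D \<ge> 0" using qS[of m] by simp
  \<comment> \<open>The first summand will pay for the initial value \<open>G m\<close>, the second
    for all later increments of \<open>G\<close>.\<close>
  define B where "B = (G m * S m / (a m)\<^sup>2 + e * D) / c + 1"
  have "(a m)\<^sup>2 > 0" using a_pos[of m] const by simp
  then have B1: "B \<ge> 1" unfolding B_def using G0 S0 D0 const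
    by (auto intro!: divide_nonneg_pos add_nonneg_nonneg mult_nonneg_nonneg)
  have bounded: "real k * G k / (a k)\<^sup>2 \<le> B" if k: "k \<ge> m" for k
  proof -
    have ak: "(a k)\<^sup>2 > 0" using a_pos[of k] k const by auto
    \<comment> \<open>After telescoping \<open>G k\<close>, this is applied at \<open>m\<close> and
      at each \<open>Suc n \<le> k\<close>. It replaces the \<open>k\<close>-dependent weight of an
      increment by \<open>S (Suc n) / c\<close>, so that \<open>qS\<close> bounds the sum uniformly
      in \<open>k\<close>.\<close>
    have gr: "real k * (a n)\<^sup>2 / (a k)\<^sup>2 \<le> S n / c" if "n \<ge> m" "k \<ge> n" for n
      using growth[OF that] ak const by (simp add: field_simps)
    have "G k = G m + (\<Sum>n = m..<k. G (Suc n) - G n)"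
      using sum_Suc_diff'[of m k G] k by simp
    also have "\<dots> \<le> G m + (\<Sum>n = m..<k. e * (a (Suc n))\<^sup>2 * q n)"
      unfolding q_def by (intro add_left_mono sum_mono G_diff) (use const in auto)
    finally have "real k / (a k)\<^sup>2 * G k
        \<le> real k / (a k)\<^sup>2 * (G m + (\<Sum>n = m..<k. e * (a (Suc n))\<^sup>2 * q n))"
      by (rule mult_left_mono) simp
    also have "\<dots> = (real k * (a m)\<^sup>2 / (a k)\<^sup>2) * (G m / (a m)\<^sup>2)
        + (\<Sum>n = m..<k. (real k * (a (Suc n))\<^sup>2 / (a k)\<^sup>2) * (e * q n))"
      using \<open>(a m)\<^sup>2 > 0\<close> by (simp add: distrib_left sum_distrib_left mult_ac)
    also have "\<dots> \<le> S m / c * (G m / (a m)\<^sup>2) + (\<Sum>n = m..<k. S (Suc n) / c * (e * q n))"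
      by (intro add_mono sum_mono mult_right_mono gr) (use k const G0 q0 in auto)
    also have "(\<Sum>n = m..<k. S (Suc n) / c * (e * q n)) = e / c * (\<Sum>n = m..<k. q n * S (Suc n))"
      by (simp add: sum_distrib_left mult_ac)
    also have "\<dots> \<le> e / c * D"
      by (intro mult_left_mono qS) (use const in auto)
    finally show ?thesis unfolding B_def using const by (simp add: field_simps)
  qed
  define V where "V n = (\<Sum>i. w (n + i))" for n
  have sumw: "summable (\<lambda>i. w (n + i))" if "n \<ge> m" for n
    using w_sum summable_iff_shift[of w m] summable_iff_shift[of w n] by (simp add: add.commute)
  have V_rec: "V n = w n + V (Suc n)" if "n \<ge> m" for n
    using suminf_split_head[OF sumw[OF that]] by (simp add: V_def)
  have V0: "V n \<ge> 0" if "n \<ge> m" for n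
    unfolding V_def by (intro suminf_nonneg sumw that w0) (use that const in auto)
  define E where "E = \<theta> * C * e * B powr (\<theta> - 1)"
  have E0: "E \<ge> 0" using const by (simp add: E_def)
  have inc: "(G (Suc k) powr \<theta> - G k powr \<theta>) * V (Suc k) \<le> E * (q k * S (Suc k))"
    if k: "k \<ge> m" for k
  proof -
    let ?n = "Suc k"
    have k1: "k \<ge> 1" using k const by simp
    have an: "a ?n > 0" using a_pos by simp
    have "G ?n powr \<theta> - G k powr \<theta> \<le> \<theta> * G ?n powr (\<theta> - 1) * (G ?n - G k)"
      by (intro powr_diff_le G0 G_mono k1 const)
    also have "\<dots> \<le> \<theta> * G ?n powr (\<theta> - 1) * (e * (a ?n)\<^sup>2 * q k)"
      unfolding q_def by (intro mult_left_mono G_diff k1) (use const in auto)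
    finally have "(G ?n powr \<theta> - G k powr \<theta>) * V ?n
        \<le> (\<theta> * G ?n powr (\<theta> - 1) * (e * (a ?n)\<^sup>2 * q k)) * V ?n"
      by (rule mult_right_mono) (use k V0 in auto)
    also have "\<dots> \<le> (\<theta> * G ?n powr (\<theta> - 1) * (e * (a ?n)\<^sup>2 * q k))
        * (C * real ?n powr (\<theta> - 1) * S ?n / a ?n powr (2 * \<theta>))"
      unfolding V_def by (intro mult_left_mono w_tail) (use k k1 const q0 in auto)
    also have "\<dots> = \<theta> * C * e * (real ?n * G ?n / (a ?n)\<^sup>2) powr (\<theta> - 1) * (q k * S ?n)"
    proof -
      \<comment> \<open>The factor \<open>(a ?n)\<^sup>2\<close> cancels the one from the increment
        of \<open>G\<close>; what remains combines into the ratio already bounded by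
        \<open>B\<close>, raised to \<theta> - 1.\<close>
      have "a ?n powr (2 * \<theta>) = ((a ?n)\<^sup>2) powr (\<theta> - 1) * (a ?n)\<^sup>2"
      proof -
        have "((a ?n)\<^sup>2) powr (\<theta> - 1) * (a ?n)\<^sup>2 = a ?n powr (2 * (\<theta> - 1)) * a ?n powr 2"
          using an by (simp only: square_powr powr_numeral)
        also have "\<dots> = a ?n powr (2 * \<theta>)" by (simp add: powr_add[symmetric] algebra_simps)
        finally show ?thesis by simp
      qed
      moreover have "(real ?n * G ?n / (a ?n)\<^sup>2) powr (\<theta> - 1)
          = real ?n powr (\<theta> - 1) * G ?n powr (\<theta> - 1) / ((a ?n)\<^sup>2) powr (\<theta> - 1)"
        using G0 by (simp add: powr_divide powr_mult)
      ultimately show ?thesis using an by (simp add: field_simps)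
    qed
    also have "\<dots> \<le> \<theta> * C * e * B powr (\<theta> - 1) * (q k * S ?n)"
      by (intro mult_right_mono mult_left_mono powr_mono2 bounded mult_nonneg_nonneg
          divide_nonneg_nonneg)
        (use k k1 const q0 S0 G0 in auto)
    finally show ?thesis by (simp add: E_def)
  qed
  show ?thesis
  proof (rule summableI_nonneg_bounded)
    show "0 \<le> w (m + i) * G (m + i) powr \<theta>" for i using w0 const by simp
    fix K
    have "(\<Sum>i<K. w (m + i) * G (m + i) powr \<theta>) = (\<Sum>k = m..<m + K. w k * G k powr \<theta>)"
      by (simp add: sum.atLeastLessThan_shift_0[of _ m "m+K"] lessThan_atLeast0 comp_def)
    also have "\<dots> = G m powr \<theta> * V m
        + (\<Sum>k = m..<m+K. (G (Suc k) powr \<theta> - G k powr \<theta>) * V (Suc k)) - G (m+K) powr \<theta> * V (m+K)"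
      by (rule abel_sum_tail) (rule V_rec)
    also have "\<dots> \<le> G m powr \<theta> * V m
        + (\<Sum>k = m..<m+K. (G (Suc k) powr \<theta> - G k powr \<theta>) * V (Suc k))"
      using V0[of "m+K"] by simp
    also have "\<dots> \<le> G m powr \<theta> * V m + (\<Sum>k = m..<m+K. E * (q k * S (Suc k)))"
      by (intro add_left_mono sum_mono inc) auto
    also have "\<dots> \<le> G m powr \<theta> * V m + E * D"
      unfolding sum_distrib_left[symmetric] by (intro add_left_mono mult_left_mono qS E0)
    finally show "(\<Sum>i<K. w (m + i) * G (m + i) powr \<theta>) \<le> G m powr \<theta> * V m + E * D" .
  qed
qed

section \<open>Real-valued forms of the hypotheses\<close>

text \<open>In \<open>ennreal\<close> a divergent series has value \<open>top\<close>, and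
  \<open>top\<close> times a positive factor is \<open>top\<close>; a finite bound therefore yields
  convergence as well as an estimate.\<close>

lemma summable_of_ennreal_suminf_bound:
  fixes f :: "nat \<Rightarrow> real"
  assumes "\<And>i. f i \<ge> 0" "b > 0" "R \<ge> 0"
    and le: "ennreal b * (\<Sum>i. ennreal (f i)) \<le> ennreal R"
  shows "summable f" "suminf f \<le> R / b"
proof -
  have "(\<Sum>i. ennreal (f i)) \<noteq> top"
  proof
    assume "(\<Sum>i. ennreal (f i)) = top"
    with le \<open>b > 0\<close> have "top \<le> ennreal R" by (simp add: ennreal_mult_top)
    then show False by (simp add: top_unique)
  qed
  then show "summable f"
    by (intro summable_suminf_not_top assms) auto
  then have "(\<Sum>i. ennreal (f i)) = ennreal (suminf f)"
    by (intro suminf_ennreal2 assms)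
  with le have "ennreal (b * suminf f) \<le> ennreal R"
    using \<open>b > 0\<close> by (simp only: ennreal_mult' less_imp_le)
  then have "b * suminf f \<le> R" using \<open>R \<ge> 0\<close> by simp
  then show "suminf f \<le> R / b" using \<open>b > 0\<close> by (simp add: field_simps)
qed

text \<open>Pick \<open>c\<close> strictly between 0 and the liminf. Eventually the infimum over
  \<open>k \<ge> n\<close> exceeds \<open>c\<close>, and for \<open>n \<ge> 1\<close> the
  denominators are positive and can be cleared.\<close>

lemma eventually_growth_of_liminf:
  fixes a S :: "nat \<Rightarrow> real"
  assumes a_pos: "\<And>n. n \<ge> 1 \<Longrightarrow> a n > 0"
    and lim: "liminf (\<lambda>n. INF k\<in>{n..}. ereal ((a k)\<^sup>2 / (real k * (a n)\<^sup>2) * S n)) > 0"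
  obtains c where "c > 0"
    "eventually (\<lambda>n. \<forall>k\<ge>n. c * (real k * (a n)\<^sup>2) \<le> (a k)\<^sup>2 * S n) sequentially"
proof -
  obtain c where c: "0 < ereal c"
    "ereal c < liminf (\<lambda>n. INF k\<in>{n..}. ereal ((a k)\<^sup>2 / (real k * (a n)\<^sup>2) * S n))"
    using ereal_dense2[OF lim] by auto
  have "eventually (\<lambda>n. \<forall>k\<ge>n. c * (real k * (a n)\<^sup>2) \<le> (a k)\<^sup>2 * S n) sequentially"
    using less_LiminfD[OF c(2)] eventually_ge_at_top[of 1]
  proof eventually_elim
    case (elim n)
    show ?case
    proof (intro allI impI)
      fix k assume "k \<ge> n"
      then have "ereal c \<le> ereal ((a k)\<^sup>2 / (real k * (a n)\<^sup>2) * S n)"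
        using elim(1) by (meson INF_lower atLeast_iff less_imp_le order_trans)
      moreover have "real k * (a n)\<^sup>2 > 0" using elim(2) a_pos[of n] \<open>k \<ge> n\<close> by auto
      ultimately show "c * (real k * (a n)\<^sup>2) \<le> (a k)\<^sup>2 * S n"
        by (simp add: field_simps)
    qed
  qed
  with c(1) show ?thesis by (intro that[of c]) auto
qed

section \<open>The exponential series\<close>

theorem theorem2:
  fixes \<tau> a :: "nat \<Rightarrow> real" and \<theta> C N :: real
    and M :: "'w measure" and X :: "'w \<Rightarrow> real"
  assumes tau_nonneg: "\<And>n. n \<ge> 1 \<Longrightarrow> \<tau> n \<ge> 0"
    and a_pos: "\<And>n. n \<ge> 1 \<Longrightarrow> a n > 0"
    and a_mono: "mono_on {1..} a"
    and constants: "\<theta> \<ge> 1" "C > 0" "N \<ge> 2"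
    and tail: "\<And>n. real n \<ge> N \<Longrightarrow>
      ennreal (a n powr (2 * \<theta>) / real n powr (\<theta> - 1)) *
        (\<Sum>i. ennreal (real (n + i) powr \<theta> * \<tau> (n + i) / a (n + i) powr (2 * \<theta>)))
      \<le> ennreal (C * (\<Sum>k = 1..<n. real k * \<tau> k))"
    and liminf_pos: "liminf (\<lambda>n. INF k\<in>{n..}.
        ereal ((a k)\<^sup>2 / (real k * (a n)\<^sup>2) * (\<Sum>j = 1..<n. real j * \<tau> j))) > 0"
    and "prob_space M"
    and "X \<in> borel_measurable M"
    and prob_sum: "\<And>\<epsilon>. \<epsilon> > 0 \<Longrightarrow>
      summable (\<lambda>i. real (Suc i) * \<tau> (Suc i) * \<P>(\<omega> in M. \<bar>X \<omega>\<bar> \<ge> \<epsilon> * a (Suc i)))"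
  shows "\<forall>\<epsilon>>0. summable (\<lambda>i. \<tau> (Suc i) *
      exp_neg_div (\<epsilon>\<^sup>2 * (a (Suc i))\<^sup>2)
        (real (Suc i) * trunc_second_moment M X (\<epsilon> * a (Suc i))))"
proof (intro allI impI)
  fix \<epsilon> :: real assume \<epsilon>: "\<epsilon> > 0"
  note prob_sum_eps = prob_sum[OF \<epsilon>]
  interpret prob_space M by fact
  define S where "S n = (\<Sum>j = 1..<n. real j * \<tau> j)" for n
  define w where "w n = real n powr \<theta> * \<tau> n / a n powr (2 * \<theta>)" for n
  define G where "G n = trunc_second_moment M X (\<epsilon> * a n)" for n
  define p where "p n = \<P>(\<omega> in M. \<bar>X \<omega>\<bar> \<ge> \<epsilon> * a n)" for n
  define D where "D = (\<Sum>i. real (Suc i) * \<tau> (Suc i) * p (Suc i))"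
  have Xm [measurable]: "X \<in> borel_measurable M" by fact
  have S0: "S n \<ge> 0" for n unfolding S_def by (intro sum_nonneg) (use tau_nonneg in auto)
  have w0: "w n \<ge> 0" if "n \<ge> 1" for n unfolding w_def using tau_nonneg[OF that] by simp
  obtain c where c: "c > 0"
    "eventually (\<lambda>n. \<forall>k\<ge>n. c * (real k * (a n)\<^sup>2) \<le> (a k)\<^sup>2 * S n) sequentially"
    using eventually_growth_of_liminf[OF a_pos liminf_pos[folded S_def]] by blast
  then obtain n0 where n0: "\<And>n k. n \<ge> n0 \<Longrightarrow> k \<ge> n \<Longrightarrow> c * (real k * (a n)\<^sup>2) \<le> (a k)\<^sup>2 * S n"
    unfolding eventually_sequentially by blast
  \<comment> \<open>From \<open>m\<close> on, \<open>a n\<close> is positive, the growth bound holds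
    and the tail hypothesis applies.\<close>
  define m where "m = max (max 1 n0) (nat \<lceil>N\<rceil>)"
  have m1: "m \<ge> 1" and mN: "real m \<ge> N" unfolding m_def by linarith+
  have a_le: "\<epsilon> * a n \<le> \<epsilon> * a (Suc n)" if "n \<ge> 1" for n
    using mono_onD[OF a_mono, of n "Suc n"] that \<epsilon> by simp
  have w_bound: "summable (\<lambda>i. w (n + i))"
    "(\<Sum>i. w (n + i)) \<le> C * real n powr (\<theta> - 1) * S n / a n powr (2 * \<theta>)" if n: "n \<ge> m" for n
  proof -
    have n1: "n \<ge> 1" using n m1 by simp
    have pos: "a n powr (2 * \<theta>) / real n powr (\<theta> - 1) > 0"
      using a_pos[OF n1] n1 by simp
    have le: "ennreal (a n powr (2 * \<theta>) / real n powr (\<theta> - 1)) * (\<Sum>i. ennreal (w (n + i)))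
      \<le> ennreal (C * S n)"
      using tail[of n] n mN unfolding w_def S_def by simp
    note bound = summable_of_ennreal_suminf_bound[OF w0 pos _ le]
    show "summable (\<lambda>i. w (n + i))"
      by (rule bound) (use n1 constants S0 in auto)
    have "(\<Sum>i. w (n + i)) \<le> C * S n / (a n powr (2 * \<theta>) / real n powr (\<theta> - 1))"
      by (rule bound) (use n1 constants S0 in auto)
    then show "(\<Sum>i. w (n + i)) \<le> C * real n powr (\<theta> - 1) * S n / a n powr (2 * \<theta>)"
      by (simp add: mult_ac)
  qed
  have p_sum: "(\<Sum>j = 1..<K. real j * \<tau> j * p j) \<le> D" for K
  proof -
    have "(\<Sum>j = 1..<K. real j * \<tau> j * p j) = (\<Sum>i<K - 1. real (Suc i) * \<tau> (Suc i) * p (Suc i))"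
      by (rule sum.reindex_bij_witness[of _ Suc "\<lambda>j. j - 1"]) auto
    also have "\<dots> \<le> D"
      unfolding D_def
      by (rule sum_le_suminf) (use prob_sum_eps tau_nonneg in \<open>auto simp: p_def\<close>)
    finally show ?thesis .
  qed
  have main: "summable (\<lambda>i. w (m + i) * G (m + i) powr \<theta>)"
    unfolding w_def
  proof (rule summable_powr_of_tail_bounds[where C = C and c = c and e = "\<epsilon>\<^sup>2" and D = D and p = p])
    show "G n \<ge> 0" for n unfolding G_def by (rule trunc_second_moment_nonneg)
    show "G n \<le> G (Suc n)" if "n \<ge> 1" for n
      unfolding G_def by (intro trunc_second_moment_mono a_le that Xm)
    show "G (Suc n) - G n \<le> \<epsilon>\<^sup>2 * (a (Suc n))\<^sup>2 * (p n - p (Suc n))" if "n \<ge> 1" for n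
      using trunc_second_moment_diff_le[OF Xm _ a_le[OF that]] \<epsilon> a_pos[OF that]
      unfolding G_def p_def by (simp add: power_mult_distrib)
    show "p n \<ge> 0" for n by (simp add: p_def)
    show "p (Suc n) \<le> p n" if "n \<ge> 1" for n
      unfolding p_def by (rule finite_measure_mono) (use a_le[OF that] in auto)
    show "c * (real k * (a n)\<^sup>2) \<le> (a k)\<^sup>2 * (\<Sum>j = 1..<n. real j * \<tau> j)"
      if "m \<le> n" "n \<le> k" for n k
      using n0[of n k] that by (simp add: m_def S_def)
  qed (use tau_nonneg a_pos constants c m1 \<epsilon> p_sum w_bound in \<open>auto simp: w_def S_def\<close>)
  define F where "F n = \<tau> n * exp_neg_div (\<epsilon>\<^sup>2 * (a n)\<^sup>2) (real n * G n)" for n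
  have G0: "G n \<ge> 0" for n unfolding G_def by (rule trunc_second_moment_nonneg)
  \<comment> \<open>The power bound on the exponential separates a constant from a term of the
    series in \<open>main\<close>, with \<open>\<tau> n\<close> absorbed into
    \<open>w n\<close>.\<close>
  have F_le: "F n \<le> (\<theta> / \<epsilon>\<^sup>2) powr \<theta> * (w n * G n powr \<theta>)" if n: "n \<ge> 1" for n
  proof -
    have an: "a n > 0" by (rule a_pos[OF n])
    have "exp_neg_div (\<epsilon>\<^sup>2 * (a n)\<^sup>2) (real n * G n)
        \<le> (\<theta> * (real n * G n) / (\<epsilon>\<^sup>2 * (a n)\<^sup>2)) powr \<theta>"
      by (rule exp_neg_div_le_powr) (use an \<epsilon> G0 constants in auto)
    also have "\<dots> = (\<theta> / \<epsilon>\<^sup>2 * (real n * G n / (a n)\<^sup>2)) powr \<theta>" by simp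
    also have "\<dots> = (\<theta> / \<epsilon>\<^sup>2) powr \<theta> * (real n powr \<theta> * G n powr \<theta> / ((a n)\<^sup>2) powr \<theta>)"
      using constants G0 by (subst powr_mult) (auto simp: powr_divide powr_mult)
    also have "((a n)\<^sup>2) powr \<theta> = a n powr (2 * \<theta>)"
      using an by (rule square_powr)
    finally have "F n \<le> \<tau> n * ((\<theta> / \<epsilon>\<^sup>2) powr \<theta> * (real n powr \<theta> * G n powr \<theta> / a n powr (2 * \<theta>)))"
      unfolding F_def by (rule mult_left_mono) (rule tau_nonneg[OF n])
    then show ?thesis by (simp add: w_def mult_ac)
  qed
  have F0: "F n \<ge> 0" if "n \<ge> 1" for n
    unfolding F_def using tau_nonneg[OF that] by (simp add: exp_neg_div_def)
  \<comment> \<open>Comparison works from \<open>m\<close> on; the finitely many earlier terms do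
    not affect summability.\<close>
  have "summable (\<lambda>i. F (m + i))"
    by (rule summable_comparison_test'[OF summable_mult[OF main, of "(\<theta> / \<epsilon>\<^sup>2) powr \<theta>"]])
      (use F0 F_le m1 in auto)
  then have "summable F" using summable_iff_shift[of F m] by (simp add: add.commute)
  then have "summable (\<lambda>i. F (Suc i))" by (simp add: summable_Suc_iff)
  then show "summable (\<lambda>i. \<tau> (Suc i) * exp_neg_div (\<epsilon>\<^sup>2 * (a (Suc i))\<^sup>2)
        (real (Suc i) * trunc_second_moment M X (\<epsilon> * a (Suc i))))"
    by (simp only: F_def G_def)
qed

end
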